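(* Let $l\ge 0$ be an integer, and let $\sigma,\tau,w$ on the open interval $(a,b)$ and the complementary polynomials ${\cal P}_\nu(x;l)$ be as in the context. Then for all integers $\nu\ge 0$ and all $x\in(a,b)$, $${\cal P}_{\nu}(x;l)=w(x)^{-1}\sigma(x)^{\nu-l}\frac{d^{\nu}}{dx^{\nu}}\big[w(x)\sigma(x)^{l}\big],$$ and for all integers $0\le\mu\le\nu$ and all $x\in(a,b)$, $${\cal P}_{\nu}(x;l)=w(x)^{-1}\sigma(x)^{\nu-l}\frac{d^{\nu-\mu}}{dx^{\nu-\mu}}\Big(\sigma(x)^{l-\mu}w(x)\,{\cal P}_{\mu}(x;l)\Big).$$
   Context: $\sigma(x)=ex^2+2fx+g$ is a real polynomial of degree at most $2$ and $\tau$ is a real polynomial of degree at most $1$. $(a,b)\subseteq\mathbb R$ is a nonempty open (possibly unbounded) interval containing no zero of $\sigma$, and $w:(a,b)\to\mathbb R$ is a differentiable, nowhere vanishing function satisfying Pearson's equation $\sigma(x)w'(x)=[\tau(x)-\sigma'(x)]w(x)$ on $(a,b)$ (so $w$ is infinitely differentiable). The complementary polynomials are defined by ${\cal P}_0(x;l)\equiv1$ and, for $\nu\ge0$, ${\cal P}_{\nu+1}(x;l)=\sigma(x)\frac{d}{dx}{\cal P}_\nu(x;l)+[\tau(x)+(l-\nu-1)\sigma'(x)]{\cal P}_\nu(x;l)$. *)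

theory Defs
  imports "HOL-Analysis.Analysis" "HOL-Computational_Algebra.Polynomial"
begin

(* The coefficient l - nu - 1 is an integer and may be negative, so it is computed in int. *)
primrec complementary_poly :: "real poly \<Rightarrow> real poly \<Rightarrow> nat \<Rightarrow> nat \<Rightarrow> real poly" where
  "complementary_poly \<sigma> \<tau> l 0 = 1"
| "complementary_poly \<sigma> \<tau> l (Suc \<nu>) =
     \<sigma> * pderiv (complementary_poly \<sigma> \<tau> l \<nu>)
     + (\<tau> + smult (of_int (int l - int \<nu> - 1)) (pderiv \<sigma>)) * complementary_poly \<sigma> \<tau> l \<nu>"

end

theory Submission
  imports Defs
begin

text \<open>
  Pearson's equation says exactly that differentiating
  \<open>F\<^sub>\<mu> = \<sigma>\<^bsup>l-\<mu>\<^esup> w P\<^sub>\<mu>\<close> gives \<open>F\<^sub>\<mu>\<^sub>+\<^sub>1\<close>: the recursion for the complementary polynomials is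
  what remains after the factor \<open>\<sigma>\<^bsup>l-\<mu>-1\<^esup> w\<close> is split off. Hence the \<open>(\<nu>-\<mu>)\<close>-th derivative of
  \<open>F\<^sub>\<mu>\<close> is \<open>F\<^sub>\<nu>\<close>, and both formulas follow by solving for \<open>P\<^sub>\<nu>\<close>.
\<close>

text \<open>Induction on \<open>k\<close>. The induction hypothesis identifies the
  \<open>k\<close>-th derivative with \<open>F (m + k)\<close> only on \<open>S\<close>; since
  \<open>S\<close> is open, this holds near \<open>x\<close>, which is enough to transfer the
  derivative.\<close>

lemma funpow_deriv_chain:
  fixes F :: "nat \<Rightarrow> 'a \<Rightarrow> 'a::real_normed_field"
  assumes "open S"
    and F: "\<And>m x. x \<in> S \<Longrightarrow> (F m has_field_derivative F (Suc m) x) (at x)"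
    and "x \<in> S"
  shows "(deriv ^^ k) (F m) x = F (m + k) x"
  using \<open>x \<in> S\<close>
proof (induction k arbitrary: x)
  case 0
  then show ?case by simp
next
  case (Suc k)
  have "((deriv ^^ k) (F m) has_field_derivative F (Suc (m + k)) x) (at x)"
    using F[OF Suc.prems] \<open>open S\<close> Suc.prems
    by (rule has_field_derivative_transform_within_open) (simp add: Suc.IH)
  then show ?case
    by (simp add: DERIV_imp_deriv)
qed

lemma has_field_derivative_weighted_complementary_poly:
  fixes \<sigma> \<tau> :: "real poly" and w :: "real \<Rightarrow> real"
  assumes nz: "poly \<sigma> x \<noteq> 0"
    and w: "w differentiable (at x)"
    and pearson: "poly \<sigma> x * deriv w x = (poly \<tau> x - poly (pderiv \<sigma>) x) * w x"
  shows "((\<lambda>y. poly \<sigma> y powi (int l - int m) * w y * poly (complementary_poly \<sigma> \<tau> l m) y)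
           has_field_derivative
           poly \<sigma> x powi (int l - int (Suc m)) * w x * poly (complementary_poly \<sigma> \<tau> l (Suc m)) x)
         (at x)"
proof -
  define n where "n = int l - int (Suc m)"
  define P where "P = complementary_poly \<sigma> \<tau> l m"
  define s where "s = poly \<sigma> x powi n"
  have n: "int l - int m = n + 1"
    by (simp add: n_def)
  have w': "(w has_field_derivative deriv w x) (at x)"
    using w DERIV_deriv_iff_real_differentiable by blast
  \<comment> \<open>Each term of the product rule is written with the common factor
    \<open>s\<close>. The spare factor \<sigma> in the middle term completes the left side of
    Pearson's equation.\<close>
  have "((\<lambda>y. poly \<sigma> y powi (n + 1) * w y * poly P y) has_field_derivative
          of_int (n + 1) * s * poly (pderiv \<sigma>) x * w x * poly P x
          + s * (poly \<sigma> x * deriv w x) * poly P x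
          + s * poly \<sigma> x * w x * poly (pderiv P) x) (at x)"
    using nz by (auto intro!: derivative_eq_intros w' poly_DERIV simp: s_def power_int_add algebra_simps)
  also have "of_int (n + 1) * s * poly (pderiv \<sigma>) x * w x * poly P x
          + s * (poly \<sigma> x * deriv w x) * poly P x
          + s * poly \<sigma> x * w x * poly (pderiv P) x
      = s * w x * poly (complementary_poly \<sigma> \<tau> l (Suc m)) x"
    \<comment> \<open>The power contributes \<open>n + 1\<close> times \<sigma>' and Pearson's
      equation -1 times, which leaves \<open>n\<close>, the coefficient l - m - 1 of the
      recursion.\<close>
    unfolding pearson by (simp add: P_def n_def algebra_simps)
  finally show ?thesis
    by (simp only: n flip: n_def P_def s_def)
qed

theorem theorem2:
  fixes e f g :: real and \<sigma> \<tau> :: "real poly" and a b :: ereal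
    and w :: "real \<Rightarrow> real" and l :: nat
  assumes sigma: "\<sigma> = [:g, 2 * f, e:]"
    and tau: "degree \<tau> \<le> 1"
    and interval: "a < b"
    and sigma_nz: "\<And>x. x \<in> einterval a b \<Longrightarrow> poly \<sigma> x \<noteq> 0"
    and w_diff: "\<And>x. x \<in> einterval a b \<Longrightarrow> w differentiable (at x)"
    and w_nz: "\<And>x. x \<in> einterval a b \<Longrightarrow> w x \<noteq> 0"
    and pearson: "\<And>x. x \<in> einterval a b \<Longrightarrow>
           poly \<sigma> x * deriv w x = (poly \<tau> x - poly (pderiv \<sigma>) x) * w x"
  shows "(\<forall>\<nu>::nat. \<forall>x \<in> einterval a b.
            poly (complementary_poly \<sigma> \<tau> l \<nu>) x =
              inverse (w x) * poly \<sigma> x powi (int \<nu> - int l)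
                * (deriv ^^ \<nu>) (\<lambda>y. w y * poly \<sigma> y ^ l) x)
       \<and> (\<forall>(\<mu>::nat) (\<nu>::nat). \<mu> \<le> \<nu> \<longrightarrow> (\<forall>x \<in> einterval a b.
            poly (complementary_poly \<sigma> \<tau> l \<nu>) x =
              inverse (w x) * poly \<sigma> x powi (int \<nu> - int l)
                * (deriv ^^ (\<nu> - \<mu>))
                    (\<lambda>y. poly \<sigma> y powi (int l - int \<mu>) * w y
                          * poly (complementary_poly \<sigma> \<tau> l \<mu>) y) x))"
proof -
  let ?S = "einterval a b"
  define F where "F m = (\<lambda>y. poly \<sigma> y powi (int l - int m) * w y
    * poly (complementary_poly \<sigma> \<tau> l m) y)" for m
  have F_deriv: "(F m has_field_derivative F (Suc m) x) (at x)" if "x \<in> ?S" for m x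
    unfolding F_def using that
    by (intro has_field_derivative_weighted_complementary_poly sigma_nz w_diff pearson)
  have general: "poly (complementary_poly \<sigma> \<tau> l \<nu>) x =
      inverse (w x) * poly \<sigma> x powi (int \<nu> - int l) * (deriv ^^ (\<nu> - \<mu>)) (F \<mu>) x"
    if "\<mu> \<le> \<nu>" "x \<in> ?S" for \<mu> \<nu> x
  proof -
    have "(deriv ^^ (\<nu> - \<mu>)) (F \<mu>) x = F \<nu> x"
      using funpow_deriv_chain[of ?S F x "\<nu> - \<mu>" \<mu>] F_deriv that by simp
    \<comment> \<open>The prefactor cancels the power of \<sigma> in \<open>F \<nu> x\<close>,
      whichever sign the exponent has.\<close>
    moreover have "poly \<sigma> x powi (int \<nu> - int l) * poly \<sigma> x powi (int l - int \<nu>) = 1"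
      using sigma_nz[OF that(2)] by (simp flip: power_int_add)
    ultimately show ?thesis
      using w_nz[OF that(2)] by (simp add: F_def field_simps)
  qed
  \<comment> \<open>The first formula is the case \<mu> = 0, where the integer power has exponent
    \<open>int l\<close> and becomes a natural one.\<close>
  have "F 0 = (\<lambda>y. w y * poly \<sigma> y ^ l)"
    by (simp add: F_def mult.commute)
  with general[of 0] show ?thesis
    using general by (auto simp: F_def)
qed

end
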